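(* Let $R$ be a principal ideal domain and let $I=gR\subsetneq R$ be a proper, non-prime ideal such that $Q:=R/I$ is finite. Write $g=u\cdot\prod_{i=1}^n p_i^{m_i}$ with $u$ a unit, $p_1,\dots,p_n$ pairwise non-associated prime elements and integers $m_1,\dots,m_n\ge 1$. Suppose $n\ge 2$. Then the zero divisor graph $\Gamma(Q)$ satisfies \[\dim_{TH}(\Gamma(Q))=\begin{cases} n & \text{if there is } i\in[n] \text{ with } m_i\ge 2,\\ n & \text{if } |R/p_iR|\ge 3 \text{ for all } i\in[n],\\ n-1 & \text{if } n\ge 3,\ m_i=1 \text{ for all } i\in[n], \text{ and there is } i\in[n] \text{ with } |R/p_iR|=2,\\ 1 & \text{if } n=2,\ m_1=m_2=1, \text{ and there is exactly one } i\in\{1,2\} \text{ with } |R/p_iR|=2,\\ 0 & \text{if } n=2,\ m_1=m_2=1 \text{ and } |R/p_1R|=|R/p_2R|=2. \end{cases}\]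
   Context: $[n]=\{1,\dots,n\}$. Rings are commutative and non-zero with $1$. For a ring $Q$, $Z(Q)$ is the set of $r\in Q$ for which there is $s\in Q\setminus\{0\}$ with $rs=0$. The zero divisor graph $\Gamma(Q)$ has vertex set $Z(Q)\setminus\{0\}$; two distinct vertices $r,s$ are adjacent iff $rs=0$. For a finite set $V$, $\alpha\colon V\to\mathbb{R}$ and $S\in\mathbb{R}$, the threshold graph $T(\alpha,S)$ has vertex set $V$ and edges all $\{v,w\}$, $v\neq w$, with $\alpha(v)+\alpha(w)\ge S$; a graph is a threshold graph if it is of this form. The threshold dimension $\dim_{TH}(G)$ of a finite simple graph $G$ is the minimum $d\ge 0$ such that there exist $d$ threshold graphs $H_1,\dots,H_d$ on $V(G)$ with $E(G)=\bigcap_{j=1}^d E(H_j)$; the empty intersection ($d=0$) is the set of all pairs of vertices, so $\dim_{TH}(G)=0$ iff $G$ is complete. *)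

theory Defs
  imports Complex_Main "HOL-Algebra.Algebra"
begin

text \<open>A simple graph is a pair of a vertex set and a set of two-element sets of vertices.\<close>

type_synonym 'v graph = "'v set \<times> 'v set set"

abbreviation verts :: "'v graph \<Rightarrow> 'v set" where
  "verts G \<equiv> fst G"

abbreviation edges :: "'v graph \<Rightarrow> 'v set set" where
  "edges G \<equiv> snd G"

definition all_pairs :: "'v set \<Rightarrow> 'v set set" where
  "all_pairs V = {{v, w} | v w. v \<in> V \<and> w \<in> V \<and> v \<noteq> w}"

definition threshold_graph :: "'v set \<Rightarrow> ('v \<Rightarrow> real) \<Rightarrow> real \<Rightarrow> 'v graph" where
  "threshold_graph V \<alpha> S =
     (V, {{v, w} | v w. v \<in> V \<and> w \<in> V \<and> v \<noteq> w \<and> \<alpha> v + \<alpha> w \<ge> S})"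

definition is_threshold_graph :: "'v graph \<Rightarrow> bool" where
  "is_threshold_graph G \<longleftrightarrow>
     finite (verts G) \<and> (\<exists>\<alpha> S. G = threshold_graph (verts G) \<alpha> S)"

text \<open>Intersecting inside \<^term>\<open>all_pairs (verts G)\<close> makes the empty intersection (\<open>d = 0\<close>)
  the edge set of the complete graph.\<close>

definition threshold_representable :: "'v graph \<Rightarrow> nat \<Rightarrow> bool" where
  "threshold_representable G d \<longleftrightarrow>
     (\<exists>H :: nat \<Rightarrow> 'v graph.
        (\<forall>j\<in>{1..d}. is_threshold_graph (H j) \<and> verts (H j) = verts G) \<and>
        edges G = all_pairs (verts G) \<inter> (\<Inter>j\<in>{1..d}. edges (H j)))"

definition threshold_dim :: "'v graph \<Rightarrow> nat" where
  "threshold_dim G = (LEAST d. threshold_representable G d)"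

text \<open>The minimum is attained for every finite simple graph: deleting a single edge from a
  complete graph leaves a threshold graph.\<close>

lemma threshold_representable_exists:
  assumes fin: "finite (verts G)" and sub: "edges G \<subseteq> all_pairs (verts G)"
  shows "\<exists>d. threshold_representable G d"
proof -
  let ?V = "verts G"
  let ?N = "all_pairs ?V - edges G"
  let ?T = "\<lambda>e. threshold_graph ?V (\<lambda>x. if x \<in> e then 0 else 1) (1::real)"
  have "all_pairs ?V \<subseteq> Pow ?V"
    by (auto simp: all_pairs_def)
  then have "finite ?N"
    using fin by (meson finite_Diff finite_Pow_iff finite_subset)
  then obtain f where f: "bij_betw f {1..card ?N} ?N"
    using ex_bij_betw_nat_finite_1 by blast
  have T: "edges (?T e) = all_pairs ?V - {e}" if "e \<in> ?N" for e
  proof -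
    from that obtain a b where e: "e = {a, b}" "a \<noteq> b"
      by (auto simp: all_pairs_def)
    show ?thesis
      unfolding e(1) using e(2)
      by (auto simp: threshold_graph_def all_pairs_def doubleton_eq_iff split: if_splits)
  qed
  have vT: "verts (?T e) = ?V" for e
    by (simp add: threshold_graph_def)
  have thr: "is_threshold_graph (?T e)" for e
    unfolding is_threshold_graph_def vT using fin by blast
  have "(\<Inter>j\<in>{1..card ?N}. edges (?T (f j))) = (\<Inter>e\<in>?N. edges (?T e))"
    by (subst bij_betw_imp_surj_on[OF f, symmetric]) (simp only: image_image)
  also have "\<dots> = (\<Inter>e\<in>?N. all_pairs ?V - {e})"
    using T by (intro INF_cong) auto
  finally have "edges G = all_pairs ?V \<inter> (\<Inter>j\<in>{1..card ?N}. edges (?T (f j)))"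
    using sub by auto
  then have "threshold_representable G (card ?N)"
    unfolding threshold_representable_def using thr vT
    by (intro exI[of _ "\<lambda>j. ?T (f j)"]) auto
  then show ?thesis ..
qed


definition zero_divisors :: "('a, 'm) ring_scheme \<Rightarrow> 'a set" where
  "zero_divisors Q =
     {r \<in> carrier Q. \<exists>s \<in> carrier Q - {\<zero>\<^bsub>Q\<^esub>}. r \<otimes>\<^bsub>Q\<^esub> s = \<zero>\<^bsub>Q\<^esub>}"

definition zero_divisor_graph :: "('a, 'm) ring_scheme \<Rightarrow> 'a graph" where
  "zero_divisor_graph Q =
     (let V = zero_divisors Q - {\<zero>\<^bsub>Q\<^esub>}
      in (V, {{r, s} | r s. r \<in> V \<and> s \<in> V \<and> r \<noteq> s \<and> r \<otimes>\<^bsub>Q\<^esub> s = \<zero>\<^bsub>Q\<^esub>}))"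

end

(*
The element r of Q = R/I is described by the vector of its p_i-adic valuations v_i(r), capped at m_i:
r s = 0 in Q iff v_i(r) + v_i(s) >= m_i for all i. This is an intersection of n threshold graphs.
For the lower bounds one exhibits non-edges {x_i, y_i} such that x_i y_j = 0 for all i ~= j; no two
of them can be missing from the same threshold graph. If all m_i are 1 and |R/p_k R| = 2, then only one
element has support {k}; the condition at k can then be absorbed into the threshold graphs of the
other primes, which saves one.
*)
theory Submission
  imports Defs
begin

subsection \<open>Threshold dimension\<close>

text \<open>What limits the lower bound is distinctness: a non-edge needs two different vertices x_i
  and y_i, although one element of valuation 0 at i and full valuation elsewhere already has
  non-zero square. If |R/p_i R| >= 3, multiplying such an element by a residue other than 0 and 1
  gives a second one. If some m_k >= 2, the intermediate valuation m_k - 1 at k separates x_i from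
  y_i for every i. If all m_i are 1 and a residue field has two elements, a reserved index is added
  to the support of y_i instead; this costs one pair and requires n >= 3, because for n = 2 such a
  y_i would be a unit. On the side of the graph only capped valuations occur; residue fields enter
  solely through the question whether one or several elements vanish at all indices but k and have
  valuation 0 at k.\<close>

lemma threshold_representableI:
  fixes \<alpha> :: "'i \<Rightarrow> 'v \<Rightarrow> real" and S :: "'i \<Rightarrow> real"
  assumes "finite V" "finite A"
    and E: "E = {{v, w} | v w. v \<in> V \<and> w \<in> V \<and> v \<noteq> w \<and> (\<forall>a\<in>A. \<alpha> a v + \<alpha> a w \<ge> S a)}"
  shows "threshold_representable (V, E) (card A)"
proof -
  \<comment> \<open>The index set is arbitrary so that \<open>{1..n} - {k}\<close> can serve later;
    numbering it from 1 gives the form that \<open>threshold_representable\<close> asks for.\<close>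
  obtain f where f: "bij_betw f {1..card A} A"
    using \<open>finite A\<close> ex_bij_betw_nat_finite_1 by blast
  define T where "T a = threshold_graph V (\<alpha> a) (S a)" for a
  have "(\<Inter>j\<in>{1..card A}. edges (T (f j))) = (\<Inter>a\<in>A. edges (T a))"
    by (subst bij_betw_imp_surj_on[OF f, symmetric]) (simp only: image_image)
  moreover have "e \<in> E \<longleftrightarrow> e \<in> all_pairs V \<inter> (\<Inter>a\<in>A. edges (T a))" for e
  proof (cases "e \<in> all_pairs V")
    case True
    then obtain v w where e: "e = {v, w}" "v \<in> V" "w \<in> V" "v \<noteq> w"
      by (auto simp: all_pairs_def)
    then have "e \<in> E \<longleftrightarrow> (\<forall>a\<in>A. \<alpha> a v + \<alpha> a w \<ge> S a)"
      unfolding E by (auto simp: doubleton_eq_iff add.commute)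
    moreover have "e \<in> edges (T a) \<longleftrightarrow> \<alpha> a v + \<alpha> a w \<ge> S a" for a
      using e by (auto simp: T_def threshold_graph_def doubleton_eq_iff add.commute)
    ultimately show ?thesis using True by auto
  qed (auto simp: E all_pairs_def)
  ultimately have "E = all_pairs V \<inter> (\<Inter>j\<in>{1..card A}. edges (T (f j)))" by auto
  moreover have "is_threshold_graph (T a) \<and> verts (T a) = V" for a
    using \<open>finite V\<close> by (auto simp: is_threshold_graph_def T_def threshold_graph_def)
  ultimately show ?thesis
    unfolding threshold_representable_def by (intro exI[of _ "\<lambda>j. T (f j)"]) simp
qed

lemma threshold_dim_le: "threshold_representable G d \<Longrightarrow> threshold_dim G \<le> d"
  unfolding threshold_dim_def by (rule Least_le)

lemma threshold_representable_dim:
  assumes "finite (verts G)" "edges G \<subseteq> all_pairs (verts G)"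
  shows "threshold_representable G (threshold_dim G)"
  unfolding threshold_dim_def
  using threshold_representable_exists[OF assms] by (rule LeastI_ex)

text \<open>In a threshold graph, one of the non-edges \<open>{x, y}\<close> and \<open>{x', y'}\<close> must be an edge as soon as
  \<open>{x, y'}\<close> and \<open>{x', y}\<close> are: both pairs of pairs have the same total weight. So pairwise conflicting
  non-edges are missing from different threshold graphs.\<close>

lemma card_le_threshold_dim:
  assumes fin: "finite (verts G)" and sub: "edges G \<subseteq> all_pairs (verts G)"
    and nonedge: "\<And>i. i \<in> J \<Longrightarrow>
      x i \<in> verts G \<and> y i \<in> verts G \<and> x i \<noteq> y i \<and> {x i, y i} \<notin> edges G"
    and conflict: "\<And>i j. i \<in> J \<Longrightarrow> j \<in> J \<Longrightarrow> i \<noteq> j \<Longrightarrow> {x i, y j} \<in> edges G"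
  shows "card J \<le> threshold_dim G"
proof -
  let ?d = "threshold_dim G"
  obtain H where H: "\<And>j. j \<in> {1..?d} \<Longrightarrow> is_threshold_graph (H j) \<and> verts (H j) = verts G"
    and E: "edges G = all_pairs (verts G) \<inter> (\<Inter>j\<in>{1..?d}. edges (H j))"
    using threshold_representable_dim[OF fin sub] unfolding threshold_representable_def by blast
  have "\<exists>j\<in>{1..?d}. {x i, y i} \<notin> edges (H j)" if "i \<in> J" for i
  proof -
    have "{x i, y i} \<in> all_pairs (verts G)"
      using nonedge[OF that] by (auto simp: all_pairs_def)
    then show ?thesis using nonedge[OF that] E by blast
  qed
  then obtain f where f: "\<And>i. i \<in> J \<Longrightarrow> f i \<in> {1..?d} \<and> {x i, y i} \<notin> edges (H (f i))"
    by metis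
  have "inj_on f J"
  proof (rule inj_onI, rule ccontr)
    fix i j assume ij: "i \<in> J" "j \<in> J" "f i = f j" "i \<noteq> j"
    obtain \<alpha> S where T: "H (f i) = threshold_graph (verts G) \<alpha> S"
      using H f[OF ij(1)] unfolding is_threshold_graph_def by metis
    have *: "{v, w} \<in> edges (H (f i)) \<longleftrightarrow> \<alpha> v + \<alpha> w \<ge> S"
      if "v \<in> verts G" "w \<in> verts G" "v \<noteq> w" for v w
      using that by (auto simp: T threshold_graph_def doubleton_eq_iff add.commute)
    have ne: "v \<noteq> w" if "{v, w} \<in> edges G" for v w
      using that sub by (auto simp: all_pairs_def doubleton_eq_iff)
    have "{x i, y j} \<in> edges (H (f i))" "{x j, y i} \<in> edges (H (f i))"
      using conflict[of i j] conflict[of j i] ij E f[OF ij(1)] by auto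
    then have "\<alpha> (x i) + \<alpha> (y j) \<ge> S" "\<alpha> (x j) + \<alpha> (y i) \<ge> S"
      using * ne conflict ij nonedge by metis+
    moreover have "\<alpha> (x i) + \<alpha> (y i) < S" "\<alpha> (x j) + \<alpha> (y j) < S"
      using *[of "x i" "y i"] *[of "x j" "y j"] nonedge ij f by (metis not_le)+
    ultimately show False by linarith
  qed
  then show ?thesis
    using card_inj_on_le[of f J "{1..?d}"] f by (simp add: image_subset_iff)
qed

lemma threshold_dim_complete: "threshold_dim (V, all_pairs V) = 0"
  using threshold_dim_le[of "(V, all_pairs V)" 0] by (auto simp: threshold_representable_def)

subsection \<open>Zero-divisor graphs with capped valuations\<close>

text \<open>Each \<open>v i\<close> plays the role of the \<open>p\<^sub>i\<close>-adic valuation capped at \<open>m i\<close>.\<close>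

locale valued_quotient =
  fixes Q :: "('q, 'm) ring_scheme" (structure) and v :: "nat \<Rightarrow> 'q \<Rightarrow> nat"
    and m :: "nat \<Rightarrow> nat" and n :: nat
  assumes finite_carrier: "finite (carrier Q)"
    and zero_carrier: "\<zero> \<in> carrier Q"
    and val_le: "\<And>i x. i \<in> {1..n} \<Longrightarrow> x \<in> carrier Q \<Longrightarrow> v i x \<le> m i"
    and zero_iff: "\<And>x. x \<in> carrier Q \<Longrightarrow> x = \<zero> \<longleftrightarrow> (\<forall>i\<in>{1..n}. v i x = m i)"
    and mult_zero_iff: "\<And>x y. x \<in> carrier Q \<Longrightarrow> y \<in> carrier Q \<Longrightarrow>
      x \<otimes> y = \<zero> \<longleftrightarrow> (\<forall>i\<in>{1..n}. m i \<le> v i x + v i y)"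
    and val_realize: "\<And>a. (\<And>i. i \<in> {1..n} \<Longrightarrow> a i \<le> m i) \<Longrightarrow>
      \<exists>x\<in>carrier Q. \<forall>i\<in>{1..n}. v i x = a i"
    and exponent_pos: "\<And>i. i \<in> {1..n} \<Longrightarrow> m i \<ge> 1"
    and n_ge_2: "n \<ge> 2"
begin

section \<open>Vertices and edges read off from valuations\<close>

definition V where "V = verts (zero_divisor_graph Q)"

text \<open>In the model R/gR these correspond, under the Chinese remainder isomorphism, to the
  elements that are a unit in component \<open>k\<close> and zero in all others. If all exponents
  are 1, only the vector of zero lies above theirs in the order of valuation vectors, hence the
  name.\<close>

definition coatom :: "nat \<Rightarrow> 'q \<Rightarrow> bool" where
  "coatom k x \<longleftrightarrow> x \<in> carrier Q \<and> v k x = 0 \<and> (\<forall>i\<in>{1..n} - {k}. v i x = m i)"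

text \<open>An annihilator of \<open>x\<close> only has to supply what is missing: if
  \<open>v k x > 0\<close>, valuation \<open>m k - v k x\<close> at \<open>k\<close> and full
  valuation elsewhere give a non-zero one. Conversely, a non-zero annihilator is deficient at some
  index, and there \<open>x\<close> must have positive valuation.\<close>

lemma in_V_iff:
  "x \<in> V \<longleftrightarrow> x \<in> carrier Q \<and> (\<exists>i\<in>{1..n}. v i x < m i) \<and> (\<exists>i\<in>{1..n}. v i x > 0)"
proof
  assume "x \<in> V"
  then obtain y where x: "x \<in> carrier Q" "x \<noteq> \<zero>" and y: "y \<in> carrier Q" "y \<noteq> \<zero>" "x \<otimes> y = \<zero>"
    by (auto simp: V_def zero_divisor_graph_def zero_divisors_def Let_def)
  obtain i where i: "i \<in> {1..n}" "v i y \<noteq> m i" using y zero_iff by blast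
  moreover have "v i y \<le> m i" "m i \<le> v i x + v i y"
    using i x y val_le mult_zero_iff by blast+
  ultimately have "v i x > 0" by simp
  moreover have "\<exists>i\<in>{1..n}. v i x < m i" using x zero_iff val_le by (metis le_neq_implies_less)
  ultimately show "x \<in> carrier Q \<and> (\<exists>i\<in>{1..n}. v i x < m i) \<and> (\<exists>i\<in>{1..n}. v i x > 0)"
    using x i by blast
next
  assume A: "x \<in> carrier Q \<and> (\<exists>i\<in>{1..n}. v i x < m i) \<and> (\<exists>i\<in>{1..n}. v i x > 0)"
  then obtain k where k: "k \<in> {1..n}" "v k x > 0" by blast
  obtain y where y: "y \<in> carrier Q" "\<forall>i\<in>{1..n}. v i y = (if i = k then m k - v k x else m i)"
    using val_realize[of "\<lambda>i. if i = k then m k - v k x else m i"] by force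
  have "x \<otimes> y = \<zero>" using A y mult_zero_iff by auto
  moreover have "v k y \<noteq> m k" using y k exponent_pos[OF k(1)] by simp
  then have "y \<noteq> \<zero>" using y k zero_iff by blast
  moreover have "x \<noteq> \<zero>" using A zero_iff by (metis less_irrefl)
  ultimately show "x \<in> V"
    using A y by (auto simp: V_def zero_divisor_graph_def zero_divisors_def Let_def)
qed

lemma edges_eq: "edges (zero_divisor_graph Q) =
  {{x, y} | x y. x \<in> V \<and> y \<in> V \<and> x \<noteq> y \<and> (\<forall>i\<in>{1..n}. m i \<le> v i x + v i y)}"
proof -
  have "edges (zero_divisor_graph Q) = {{x, y} | x y. x \<in> V \<and> y \<in> V \<and> x \<noteq> y \<and> x \<otimes> y = \<zero>}"
    by (simp add: V_def zero_divisor_graph_def Let_def)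
  also have "\<dots> = {{x, y} | x y. x \<in> V \<and> y \<in> V \<and> x \<noteq> y \<and> (\<forall>i\<in>{1..n}. m i \<le> v i x + v i y)}"
    using mult_zero_iff in_V_iff by (metis (no_types, lifting))
  finally show ?thesis .
qed

lemma graph_eq: "zero_divisor_graph Q = (V, edges (zero_divisor_graph Q))"
  by (simp add: V_def)

lemma edge_iff: "{x, y} \<in> edges (zero_divisor_graph Q) \<longleftrightarrow>
  x \<in> V \<and> y \<in> V \<and> x \<noteq> y \<and> (\<forall>i\<in>{1..n}. m i \<le> v i x + v i y)"
  unfolding edges_eq by (auto simp: doubleton_eq_iff add.commute)

lemma finite_V: "finite V"
  using finite_carrier by (rule rev_finite_subset) (auto simp: in_V_iff)

lemma edges_subset: "edges (zero_divisor_graph Q) \<subseteq> all_pairs V"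
  unfolding edges_eq all_pairs_def by blast

section \<open>General bounds for the dimension\<close>

lemma dim_le: "threshold_dim (zero_divisor_graph Q) \<le> n"
proof -
  have "edges (zero_divisor_graph Q) = {{x, y} | x y. x \<in> V \<and> y \<in> V \<and> x \<noteq> y \<and>
      (\<forall>i\<in>{1..n}. real (v i x) + real (v i y) \<ge> real (m i))}"
    unfolding edges_eq of_nat_add[symmetric] of_nat_le_iff ..
  from threshold_representableI[OF finite_V _ this] show ?thesis
    using threshold_dim_le by (metis card_atLeastAtMost diff_Suc_1 finite_atLeastAtMost graph_eq)
qed

text \<open>The clause \<open>x i \<noteq> y j\<close> is demanded apart from the inequalities: an
  element whose square is zero satisfies them with itself, yet forms no edge.\<close>

lemma le_dim:
  assumes "\<And>i. i \<in> J \<Longrightarrow> x i \<in> V \<and> y i \<in> V \<and> x i \<noteq> y i \<and> (\<exists>k\<in>{1..n}. v k (x i) + v k (y i) < m k)"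
    and "\<And>i j. i \<in> J \<Longrightarrow> j \<in> J \<Longrightarrow> i \<noteq> j \<Longrightarrow>
      x i \<noteq> y j \<and> (\<forall>k\<in>{1..n}. m k \<le> v k (x i) + v k (y j))"
  shows "card J \<le> threshold_dim (zero_divisor_graph Q)"
proof (rule card_le_threshold_dim[where x = x and y = y])
  show "finite (verts (zero_divisor_graph Q))" using finite_V by (simp add: V_def)
  show "edges (zero_divisor_graph Q) \<subseteq> all_pairs (verts (zero_divisor_graph Q))"
    using edges_subset by (simp add: V_def)
qed (use assms in \<open>unfold edge_iff, auto simp: V_def[symmetric] not_le\<close>)

lemma other_index:
  obtains j where "j \<in> {1..n}" "j \<noteq> k"
  using n_ge_2 that[of 1] that[of 2] by (cases "k = 1") auto

lemma coatom_in_V: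
  assumes "k \<in> {1..n}" "coatom k x"
  shows "x \<in> V"
proof -
  obtain j where j: "j \<in> {1..n}" "j \<noteq> k"
    by (rule other_index)
  then have "v j x > 0" "v k x < m k"
    using assms exponent_pos[of j] exponent_pos[of k] by (auto simp: coatom_def)
  then show ?thesis using assms j unfolding in_V_iff coatom_def by blast
qed

text \<open>Two coatoms at \<open>i\<close> would do for x_i and y_i, but there may be only one. An
  exponent of at least 2 leaves room for the valuation \<open>m k - 1\<close> strictly between 0 and
  \<open>m k\<close>, which tells the two elements of each pair apart.\<close>

lemma dim_repeated_factor:
  assumes k: "k \<in> {1..n}" "m k \<ge> 2"
  shows "threshold_dim (zero_divisor_graph Q) = n"
proof -
  \<comment> \<open>For i \<noteq> k the element y_i is lowered by one at k. To annihilate it, x_k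
    needs positive valuation at k; \<open>m k - 1\<close> suffices because 2 (m_k - 1) >= m_k. The
    pair (x_k, y_k) remains a non-edge, as its valuations at k add up to m_k - 1.\<close>
  define a where "a i j = (if j = i then if i = k then m k - 1 else 0 else m j)" for i j
  define b where "b i j = (if j = i then 0 else if j = k then m k - 1 else m j)" for i j
  have "\<exists>x\<in>carrier Q. \<forall>j\<in>{1..n}. v j x = a i j" for i
    by (rule val_realize) (auto simp: a_def)
  then obtain x where x: "\<And>i. x i \<in> carrier Q" "\<And>i j. j \<in> {1..n} \<Longrightarrow> v j (x i) = a i j"
    by metis
  have "\<exists>x\<in>carrier Q. \<forall>j\<in>{1..n}. v j x = b i j" for i
    by (rule val_realize) (auto simp: b_def)
  then obtain y where y: "\<And>i. y i \<in> carrier Q" "\<And>i j. j \<in> {1..n} \<Longrightarrow> v j (y i) = b i j"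
    by metis
  have "card {1..n} \<le> threshold_dim (zero_divisor_graph Q)"
  proof (rule le_dim)
    fix i assume i: "i \<in> {1..n}"
    obtain j where j: "j \<in> {1..n}" "j \<noteq> i"
      by (rule other_index)
    have m: "m i \<ge> 1" "m j \<ge> 1" using i j exponent_pos by auto
    have "a i i < m i" "a i j > 0" using m j k by (auto simp: a_def)
    then have "x i \<in> V" using x i j by (auto simp: in_V_iff)
    have "b i i < m i" "b i j > 0" using m j k by (auto simp: b_def)
    then have "y i \<in> V" using y i j by (auto simp: in_V_iff)
    \<comment> \<open>The valuations at k are m_k - 1 and 0 if i = k, and m_k and m_k - 1
      otherwise.\<close>
    have "a i k \<noteq> b i k" using k by (auto simp: a_def b_def)
    then have "x i \<noteq> y i" using x y k by metis
    have "a i i + b i i < m i" using m k by (auto simp: a_def b_def)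
    then show "x i \<in> V \<and> y i \<in> V \<and> x i \<noteq> y i \<and> (\<exists>k\<in>{1..n}. v k (x i) + v k (y i) < m k)"
      using \<open>x i \<in> V\<close> \<open>y i \<in> V\<close> \<open>x i \<noteq> y i\<close> x y i by metis
  next
    fix i j assume ij: "i \<in> {1..n}" "j \<in> {1..n}" "i \<noteq> j"
    then have "a i j \<noteq> b j j" using exponent_pos[of j] by (auto simp: a_def b_def)
    then have "x i \<noteq> y j" using x y ij by metis
    moreover have "m l \<le> a i l + b j l" for l
      using k ij by (auto simp: a_def b_def)
    ultimately show "x i \<noteq> y j \<and> (\<forall>l\<in>{1..n}. m l \<le> v l (x i) + v l (y j))"
      using x y by simp
  qed
  with dim_le show ?thesis by simp
qed

text \<open>Coatoms at different indices annihilate each other, while two coatoms at the same index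
  \<open>k\<close> both have valuation 0 there and hence a non-zero product. A subset
  \<open>J\<close> is allowed because some indices may carry only one coatom.\<close>

lemma card_le_dim_coatoms:
  assumes J: "J \<subseteq> {1..n}" and two: "\<And>k. k \<in> J \<Longrightarrow> \<exists>x y. coatom k x \<and> coatom k y \<and> x \<noteq> y"
  shows "card J \<le> threshold_dim (zero_divisor_graph Q)"
proof -
  obtain x y where xy: "\<And>k. k \<in> J \<Longrightarrow> coatom k (x k) \<and> coatom k (y k) \<and> x k \<noteq> y k"
    using two by metis
  show ?thesis
  proof (rule le_dim[of J x y])
    fix k assume "k \<in> J"
    then show "x k \<in> V \<and> y k \<in> V \<and> x k \<noteq> y k \<and> (\<exists>l\<in>{1..n}. v l (x k) + v l (y k) < m l)"
      using xy[of k] J coatom_in_V[of k] exponent_pos[of k]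
      by (auto simp: coatom_def intro!: bexI[of _ k])
  next
    fix i j assume ij: "i \<in> J" "j \<in> J" "i \<noteq> j"
    then have "v j (x i) = m j" "v j (y j) = 0"
      using xy[of i] xy[of j] J by (auto simp: coatom_def)
    then have "x i \<noteq> y j" using exponent_pos[of j] ij J by auto
    moreover have "m l \<le> v l (x i) + v l (y j)" if "l \<in> {1..n}" for l
      using that ij xy[of i] xy[of j] unfolding coatom_def
      by (metis DiffI le_add1 le_add2 singletonD)
    ultimately show "x i \<noteq> y j \<and> (\<forall>l\<in>{1..n}. m l \<le> v l (x i) + v l (y j))" by blast
  qed
qed

lemma dim_le_unique_coatom:
  assumes m1: "\<And>i. i \<in> {1..n} \<Longrightarrow> m i = 1" and k: "k \<in> {1..n}"
    and unique: "\<And>x y. coatom k x \<Longrightarrow> coatom k y \<Longrightarrow> x = y"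
  shows "threshold_dim (zero_divisor_graph Q) \<le> n - 1"
proof -
  \<comment> \<open>Weights by membership of \<open>i\<close> and \<open>k\<close> in the support \<open>{j. v j x = 0}\<close>. Two elements with \<open>k\<close> in
    both supports are separated at any further index \<open>i\<close> of one of the supports.\<close>
  define \<alpha> :: "nat \<Rightarrow> 'q \<Rightarrow> real" where
    "\<alpha> i x = (if v i x = 0 then if v k x = 0 then -2 else -1 else if v k x = 0 then 1 else 2)" for i x
  have "(\<forall>i\<in>{1..n}. m i \<le> v i x + v i y) \<longleftrightarrow> (\<forall>i\<in>{1..n} - {k}. \<alpha> i x + \<alpha> i y \<ge> 0)"
    if xy: "x \<in> V" "y \<in> V" "x \<noteq> y" for x y
  proof
    assume "\<forall>i\<in>{1..n}. m i \<le> v i x + v i y"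
    then have nz: "v i x \<noteq> 0 \<or> v i y \<noteq> 0" if "i \<in> {1..n}" for i
      using that m1 by (metis add_0 not_one_le_zero)
    \<comment> \<open>The weights are balanced for disjoint supports: if i lies in the support of x,
      the weight of x is -2 with k in that support, and then y has weight 2; otherwise it is -1, and
      y has weight at least 1.\<close>
    have "\<alpha> i x + \<alpha> i y \<ge> 0" if "i \<in> {1..n} - {k}" for i
      using nz[of i] nz[OF k] that by (auto simp: \<alpha>_def)
    then show "\<forall>i\<in>{1..n} - {k}. \<alpha> i x + \<alpha> i y \<ge> 0" by blast
  next
    assume A: "\<forall>i\<in>{1..n} - {k}. \<alpha> i x + \<alpha> i y \<ge> 0"
    have "\<not> (v k x = 0 \<and> v k y = 0)"
    proof
      assume 0: "v k x = 0 \<and> v k y = 0"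
      have "v i x = 1 \<and> v i y = 1" if i: "i \<in> {1..n} - {k}" for i
      proof -
        \<comment> \<open>With k in both supports the weights at i can only be -2 or 1, so a
          non-negative sum forces 1 + 1.\<close>
        have "v i x \<noteq> 0 \<and> v i y \<noteq> 0"
          using 0 A[rule_format, OF i] by (auto simp: \<alpha>_def split: if_splits)
        then show ?thesis
          using i val_le[of i x] val_le[of i y] m1[of i] xy in_V_iff by auto
      qed
      then have "coatom k x" "coatom k y"
        using 0 xy m1 in_V_iff by (auto simp: coatom_def)
      with unique xy show False by blast
    qed
    moreover have "\<not> (v i x = 0 \<and> v i y = 0)" if "i \<in> {1..n} - {k}" for i
      using A[rule_format, OF that] by (auto simp: \<alpha>_def split: if_splits)
    ultimately show "\<forall>i\<in>{1..n}. m i \<le> v i x + v i y"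
      using m1 by (metis DiffI One_nat_def Suc_leI add_gr_0 neq0_conv singletonD)
  qed
  then have "edges (zero_divisor_graph Q) = {{x, y} | x y. x \<in> V \<and> y \<in> V \<and> x \<noteq> y \<and>
      (\<forall>i\<in>{1..n} - {k}. \<alpha> i x + \<alpha> i y \<ge> 0)}"
    unfolding edges_eq by (intro Collect_cong ex_cong1 conj_cong refl)
  from threshold_dim_le[OF threshold_representableI[OF finite_V _ this]] show ?thesis
    using k graph_eq by simp
qed

text \<open>Each prime may admit just one coatom, so x_i gets support {i} and y_i support {i, n}
  with \<open>n\<close> as reserved index. The supports of the y_i all meet at \<open>n\<close>,
  which is harmless: only products x_i y_j have to vanish.\<close>

lemma dim_ge_pred:
  assumes m1: "\<And>i. i \<in> {1..n} \<Longrightarrow> m i = 1" and n3: "n \<ge> 3"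
  shows "n - 1 \<le> threshold_dim (zero_divisor_graph Q)"
proof -
  define J where "J = {1..n} - {n}"
  have "\<exists>x\<in>carrier Q. \<forall>j\<in>{1..n}. v j x = (if j = i then 0 else 1)" for i
    by (rule val_realize) (auto simp: m1)
  then obtain x where x: "\<And>i. x i \<in> carrier Q"
      "\<And>i j. j \<in> {1..n} \<Longrightarrow> v j (x i) = (if j = i then 0 else 1)"
    by metis
  have "\<exists>x\<in>carrier Q. \<forall>j\<in>{1..n}. v j x = (if j = i \<or> j = n then 0 else 1)" for i
    by (rule val_realize) (auto simp: m1)
  then obtain y where y: "\<And>i. y i \<in> carrier Q"
      "\<And>i j. j \<in> {1..n} \<Longrightarrow> v j (y i) = (if j = i \<or> j = n then 0 else 1)"
    by metis
  have "card J \<le> threshold_dim (zero_divisor_graph Q)"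
  proof (rule le_dim)
    fix i assume "i \<in> J"
    then have i: "i \<in> {1..n}" "i \<noteq> n" by (auto simp: J_def)
    \<comment> \<open>An index outside {i, n} makes y_i a zero divisor; it exists because n >=
      3.\<close>
    obtain j where j: "j \<in> {1..n}" "j \<noteq> n" "j \<noteq> i"
      using n3 that[of 1] that[of 2] by (cases "i = 1") auto
    have n: "n \<in> {1..n}" using n3 by simp
    have "v j (x i) > 0" "v j (y i) > 0" "v i (x i) < m i" "v i (y i) < m i"
      "v n (x i) \<noteq> v n (y i)" "v i (x i) + v i (y i) < m i"
      using i j n m1[of i] x y by auto
    then show "x i \<in> V \<and> y i \<in> V \<and> x i \<noteq> y i \<and> (\<exists>k\<in>{1..n}. v k (x i) + v k (y i) < m k)"
      using i j x(1) y(1) unfolding in_V_iff by metis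
  next
    fix i j assume "i \<in> J" "j \<in> J" "i \<noteq> j"
    then have ij: "i \<in> {1..n}" "j \<in> {1..n}" "i \<noteq> j" "i \<noteq> n" "j \<noteq> n" by (auto simp: J_def)
    then have "v j (x i) \<noteq> v j (y j)" using x y by simp
    then have "x i \<noteq> y j" by metis
    moreover have "m l \<le> v l (x i) + v l (y j)" if "l \<in> {1..n}" for l
      using ij x(2)[OF that] y(2)[OF that] m1[OF that] by auto
    ultimately show "x i \<noteq> y j \<and> (\<forall>l\<in>{1..n}. m l \<le> v l (x i) + v l (y j))" by blast
  qed
  then show ?thesis using n3 by (simp add: J_def)
qed

text \<open>With two indices and exponents 1, every vertex is a coatom. Distinct vertices then
  belong to different indices and are adjacent, so the graph is complete.\<close>

lemma dim_two_unique_coatoms: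
  assumes n2: "n = 2" and m1: "\<And>i. i \<in> {1..n} \<Longrightarrow> m i = 1"
    and unique: "\<And>k x y. k \<in> {1..n} \<Longrightarrow> coatom k x \<Longrightarrow> coatom k y \<Longrightarrow> x = y"
  shows "threshold_dim (zero_divisor_graph Q) = 0"
proof -
  have le1: "v i x \<le> 1" if "x \<in> V" "i \<in> {1..n}" for x i
    using that val_le m1 in_V_iff by metis
  have *: "{1..n} = {1, 2}" using n2 by auto
  have cases: "coatom 1 x \<and> v 2 x = 1 \<or> coatom 2 x \<and> v 1 x = 1" if "x \<in> V" for x
    using that le1[OF that] m1 unfolding in_V_iff coatom_def * by force
  have "{x, y} \<in> edges (zero_divisor_graph Q)" if "x \<in> V" "y \<in> V" "x \<noteq> y" for x y
    using cases[OF that(1)] cases[OF that(2)] unique that m1 unfolding edge_iff * by auto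
  then have "edges (zero_divisor_graph Q) = all_pairs V"
    using edges_subset by (auto simp: all_pairs_def)
  then show ?thesis using threshold_dim_complete graph_eq by metis
qed

end

subsection \<open>Prime power divisibility in a domain\<close>

text \<open>Together with its converse, this default rewrite rule makes the simplifier loop on
  divisibility goals.\<close>

declare divides_mult_imp_divides [simp del]

context domain
begin

lemma ring_prime_not_unit: "p \<in> carrier R \<Longrightarrow> ring_prime p \<Longrightarrow> p \<notin> Units R"
  using ring_primeE(3)[of p] unfolding prime_def by blast

lemma ring_prime_divides_mult:
  "p \<in> carrier R \<Longrightarrow> ring_prime p \<Longrightarrow> x \<in> carrier R \<Longrightarrow> y \<in> carrier R \<Longrightarrow>
    p divides x \<otimes> y \<Longrightarrow> p divides x \<or> p divides y"
  using ring_primeE(3)[of p] unfolding prime_def by blast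

text \<open>Additivity of the valuation in a form that also covers zero. By induction on
  \<open>k\<close>, one factor p is split off from whichever of \<open>x\<close> and
  \<open>y\<close> it divides and cancelled on both sides.\<close>

lemma prime_power_divides_mult_iff:
  assumes p: "p \<in> carrier R" "ring_prime p" and "x \<in> carrier R" "y \<in> carrier R"
  shows "p [^] (k::nat) divides x \<otimes> y \<longleftrightarrow> (\<exists>a\<le>k. p [^] a divides x \<and> p [^] (k - a) divides y)"
proof
  show "\<exists>a\<le>k. p [^] a divides x \<and> p [^] (k - a) divides y" if "p [^] k divides x \<otimes> y"
    using that \<open>x \<in> carrier R\<close> \<open>y \<in> carrier R\<close>
  proof (induction k arbitrary: x y)
    case 0
    then show ?case by (auto simp: one_divides)
  next
    case (Suc k)
    have p0: "p \<in> carrier R - {\<zero>}" using p ring_primeE(1) by blast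
    have "p divides p [^] Suc k" using p by (simp add: divides_prod_l)
    then have "p divides x \<otimes> y" using Suc.prems(1) p(1) by (rule divides_trans)
    then consider "p divides x" | "p divides y"
      using ring_prime_divides_mult[OF p Suc.prems(2,3)] by blast
    then show ?case
    proof cases
      case 1
      then obtain z where z: "z \<in> carrier R" "x = p \<otimes> z" unfolding factor_def by blast
      have "p \<otimes> p [^] k divides p \<otimes> (z \<otimes> y)"
        using Suc.prems(1) unfolding nat_pow_Suc2[OF p(1)] z(2)
        using z(1) p(1) Suc.prems(3) by (simp add: m_assoc)
      then have "p [^] k divides z \<otimes> y"
        using mult_divides[OF _ _ p0, of "p [^] k" "z \<otimes> y"] p(1) z(1) Suc.prems(3) by simp
      then obtain a where a: "a \<le> k" "p [^] a divides z" "p [^] (k - a) divides y"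
        using Suc.IH[of z y] z(1) Suc.prems(3) by blast
      have "p [^] Suc a divides x"
        unfolding nat_pow_Suc2[OF p(1)] z(2) using a p(1) by (simp add: divides_mult)
      then show ?thesis using a by (intro exI[of _ "Suc a"]) auto
    next
      case 2
      then obtain z where z: "z \<in> carrier R" "y = p \<otimes> z" unfolding factor_def by blast
      have "p \<otimes> p [^] k divides p \<otimes> (x \<otimes> z)"
        using Suc.prems(1) unfolding nat_pow_Suc2[OF p(1)] z(2)
        using z(1) p(1) Suc.prems(2) by (simp add: m_lcomm)
      then have "p [^] k divides x \<otimes> z"
        using mult_divides[OF _ _ p0, of "p [^] k" "x \<otimes> z"] p(1) z(1) Suc.prems(2) by simp
      then obtain a where a: "a \<le> k" "p [^] a divides x" "p [^] (k - a) divides z"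
        using Suc.IH[of x z] z(1) Suc.prems(2) by blast
      have "p [^] Suc (k - a) divides y"
        unfolding nat_pow_Suc2[OF p(1)] z(2) using a p(1) by (simp add: divides_mult)
      then show ?thesis using a by (intro exI[of _ a]) (auto simp: Suc_diff_le)
    qed
  qed
next
  assume "\<exists>a\<le>k. p [^] a divides x \<and> p [^] (k - a) divides y"
  then obtain a where a: "a \<le> k" "p [^] a divides x" "p [^] (k - a) divides y" by blast
  then obtain c d where cd: "c \<in> carrier R" "d \<in> carrier R"
    "x = p [^] a \<otimes> c" "y = p [^] (k - a) \<otimes> d"
    using dividesD by metis
  have "x \<otimes> y = (p [^] a \<otimes> p [^] (k - a)) \<otimes> (c \<otimes> d)"
    using cd p by (simp add: m_ac)
  also have "p [^] a \<otimes> p [^] (k - a) = p [^] k" using a p by (simp add: nat_pow_mult)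
  finally show "p [^] k divides x \<otimes> y" using cd by (intro dividesI[of "c \<otimes> d"]) auto
qed

lemma pow_nonzero: "x \<in> carrier R \<Longrightarrow> x \<noteq> \<zero> \<Longrightarrow> x [^] (k::nat) \<noteq> \<zero>"
  by (induction k) (auto simp: integral_iff)

lemma pow_divides_pow:
  assumes "x \<in> carrier R" "(a::nat) \<le> b"
  shows "x [^] a divides x [^] b"
proof (rule dividesI)
  show "x [^] b = x [^] a \<otimes> x [^] (b - a)" using assms by (simp add: nat_pow_mult)
qed (use assms in simp)

text \<open>Write q = p c. As q is prime, it divides p or c; in the second case cancelling q would
  turn p into a unit.\<close>

lemma ring_prime_divides_imp_associated:
  assumes "p \<in> carrier R" "ring_prime p" "q \<in> carrier R" "ring_prime q" "p divides q"
  shows "p \<sim> q"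
proof -
  obtain c where c: "c \<in> carrier R" "q = p \<otimes> c" using assms unfolding factor_def by blast
  have "q divides p \<otimes> c" using assms c by auto
  then consider "q divides p" | "q divides c"
    using ring_prime_divides_mult[OF assms(3,4) assms(1) c(1)] by blast
  then show ?thesis
  proof cases
    case 1
    then show ?thesis using assms by (auto simp: associated_def)
  next
    case 2
    then obtain d where d: "d \<in> carrier R" "c = q \<otimes> d" unfolding factor_def by blast
    have "q \<otimes> \<one> = q \<otimes> (p \<otimes> d)" using c d assms by (metis m_lcomm r_one)
    then have "\<one> = p \<otimes> d"
      using m_lcancel[of q \<one> "p \<otimes> d"] ring_primeE(1)[OF assms(3,4)] assms d by simp
    then have "p \<in> Units R" using assms d divides_one by (metis dividesI)
    then show ?thesis using ring_prime_not_unit[OF assms(1,2)] by blast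
  qed
qed

lemma ring_prime_divides_finprod:
  assumes p: "p \<in> carrier R" "ring_prime p" and "finite A" "f \<in> A \<rightarrow> carrier R"
    and "p divides (\<Otimes>i\<in>A. f i)"
  shows "\<exists>i\<in>A. p divides f i"
  using assms(3-5)
proof (induction A)
  case empty
  then show ?case using p ring_prime_not_unit[OF p] divides_one[of p] by simp
next
  case (insert i A)
  then have "p divides f i \<otimes> (\<Otimes>i\<in>A. f i)" by (simp add: Pi_iff)
  then have "p divides f i \<or> p divides (\<Otimes>i\<in>A. f i)"
    using insert.prems by (intro ring_prime_divides_mult[OF p]) (auto simp: Pi_iff)
  then show ?case using insert by auto
qed

lemma ring_prime_divides_pow:
  assumes p: "p \<in> carrier R" "ring_prime p" and "x \<in> carrier R" "p divides x [^] (k::nat)"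
  shows "p divides x"
  using assms(3,4)
proof (induction k)
  case 0
  then show ?case using p ring_prime_not_unit[OF p] divides_one[of p] by simp
next
  case (Suc k)
  then show ?case using ring_prime_divides_mult[OF p, of "x [^] k" x] by auto
qed

text \<open>The cap keeps the set finite, so that zero receives the value \<open>m\<close>; it also
  makes the value depend only on the residue class of \<open>x\<close> modulo p^m.\<close>

definition capped_val :: "'a \<Rightarrow> nat \<Rightarrow> 'a \<Rightarrow> nat" where
  "capped_val p m x = Max {k. k \<le> m \<and> p [^] k divides x}"

lemma capped_val_le: "x \<in> carrier R \<Longrightarrow> capped_val p m x \<le> m"
  and le_capped_val_iff: "p \<in> carrier R \<Longrightarrow> x \<in> carrier R \<Longrightarrow> k \<le> m \<Longrightarrow>
    k \<le> capped_val p m x \<longleftrightarrow> p [^] k divides x"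
proof -
  let ?S = "{k. k \<le> m \<and> p [^] k divides x}"
  assume x: "x \<in> carrier R"
  have S: "finite ?S" "0 \<in> ?S" using x by (auto simp: one_divides)
  have "Max ?S \<in> ?S" using S by (intro Max_in) auto
  then show "capped_val p m x \<le> m" by (simp add: capped_val_def)
  assume p: "p \<in> carrier R" and k: "k \<le> m"
  show "k \<le> capped_val p m x \<longleftrightarrow> p [^] k divides x"
  proof
    assume "k \<le> capped_val p m x"
    then have "p [^] k divides p [^] Max ?S" using p by (simp add: capped_val_def pow_divides_pow)
    then show "p [^] k divides x" using \<open>Max ?S \<in> ?S\<close> p divides_trans by blast
  next
    assume "p [^] k divides x"
    then show "k \<le> capped_val p m x"
      unfolding capped_val_def using S k by (intro Max_ge) auto
  qed
qed

text \<open>Capping at \<open>m\<close> loses nothing when only the comparison with \<open>m\<close>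
  matters: the exponent is split as a + (m - a), where a can be the capped valuation of
  \<open>x\<close>.\<close>

lemma le_capped_val_add_iff:
  assumes "p \<in> carrier R" "ring_prime p" "x \<in> carrier R" "y \<in> carrier R"
  shows "m \<le> capped_val p m x + capped_val p m y \<longleftrightarrow> p [^] m divides x \<otimes> y"
proof -
  have "p [^] m divides x \<otimes> y \<longleftrightarrow> (\<exists>a\<le>m. a \<le> capped_val p m x \<and> m - a \<le> capped_val p m y)"
    using prime_power_divides_mult_iff[OF assms] assms le_capped_val_iff[of p x _ m]
      le_capped_val_iff[of p y "m - _" m] by auto
  also have "\<dots> \<longleftrightarrow> m \<le> capped_val p m x + capped_val p m y"
  proof
    assume "m \<le> capped_val p m x + capped_val p m y"
    then show "\<exists>a\<le>m. a \<le> capped_val p m x \<and> m - a \<le> capped_val p m y"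
      using capped_val_le[of x p m] assms by (intro exI[of _ "capped_val p m x"]) auto
  qed auto
  finally show ?thesis by blast
qed

text \<open>This realises prescribed valuations. A higher power of p_i could be cancelled down to
  p_i dividing the product over the other indices, hence some p_j with j \<noteq> i.\<close>

lemma capped_val_prod:
  assumes fin: "finite A" and p: "\<And>i. i \<in> A \<Longrightarrow> p i \<in> carrier R \<and> ring_prime (p i)"
    and ndiv: "\<And>i j. i \<in> A \<Longrightarrow> j \<in> A \<Longrightarrow> i \<noteq> j \<Longrightarrow> \<not> p i divides p j"
    and i: "i \<in> A" "a i \<le> m"
  shows "capped_val (p i) m (\<Otimes>j\<in>A. p j [^] (a j :: nat)) = a i"
proof -
  let ?P = "\<Otimes>j\<in>A. p j [^] a j" and ?P' = "\<Otimes>j\<in>A - {i}. p j [^] a j"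
  have closed: "?P \<in> carrier R" "?P' \<in> carrier R" using p by (simp_all add: Pi_iff)
  have pi: "p i \<in> carrier R" "ring_prime (p i)" using p i by auto
  have P: "?P = p i [^] a i \<otimes> ?P'"
    using finprod_insert[of "A - {i}" i "\<lambda>j. p j [^] a j"] fin i p by (simp add: insert_absorb Pi_iff)
  have nP': "\<not> p i divides ?P'"
  proof
    assume "p i divides ?P'"
    then obtain j where "j \<in> A - {i}" "p i divides p j [^] a j"
      using ring_prime_divides_finprod[OF pi, of "A - {i}" "\<lambda>j. p j [^] a j"] fin p by auto
    then show False using ring_prime_divides_pow[OF pi] ndiv i p by blast
  qed
  have "a i \<le> capped_val (p i) m ?P"
    using le_capped_val_iff[of "p i" ?P "a i" m] pi closed i P by (auto intro: divides_prod_r)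
  moreover have "\<not> Suc (a i) \<le> capped_val (p i) m ?P"
  proof
    assume S: "Suc (a i) \<le> capped_val (p i) m ?P"
    then have "Suc (a i) \<le> m" using capped_val_le[of ?P "p i" m] closed by simp
    then have "p i [^] a i \<otimes> p i divides p i [^] a i \<otimes> ?P'"
      using S le_capped_val_iff[of "p i" ?P "Suc (a i)" m] pi closed P by simp
    moreover have "p i [^] a i \<noteq> \<zero>"
      using pi ring_primeE(1)[OF pi] by (simp add: pow_nonzero)
    ultimately show False using mult_divides[of "p i" ?P' "p i [^] a i"] nP' pi closed by simp
  qed
  ultimately show ?thesis by simp
qed

text \<open>In the induction step x = P t, and the power of p_i splits between P and t. Any positive
  share falling to P would make p_i divide another p_j, so the whole power divides t.\<close>

lemma prod_divides_iff:
  assumes fin: "finite A" and p: "\<And>i. i \<in> A \<Longrightarrow> p i \<in> carrier R \<and> ring_prime (p i)"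
    and ndiv: "\<And>i j. i \<in> A \<Longrightarrow> j \<in> A \<Longrightarrow> i \<noteq> j \<Longrightarrow> \<not> p i divides p j"
    and x: "x \<in> carrier R"
  shows "(\<Otimes>i\<in>A. p i [^] (a i :: nat)) divides x \<longleftrightarrow> (\<forall>i\<in>A. p i [^] a i divides x)"
  using fin p ndiv
proof (induction A)
  case empty
  then show ?case using x by (simp add: one_divides)
next
  case (insert i A)
  let ?P = "\<Otimes>j\<in>A. p j [^] a j"
  have closed: "?P \<in> carrier R" "p i [^] a i \<in> carrier R"
    using insert.prems by (simp_all add: Pi_iff)
  have pi: "p i \<in> carrier R" "ring_prime (p i)" using insert.prems by auto
  have eq: "(\<Otimes>j\<in>insert i A. p j [^] a j) = p i [^] a i \<otimes> ?P"
    using insert by (simp add: Pi_iff)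
  have IH: "?P divides x \<longleftrightarrow> (\<forall>j\<in>A. p j [^] a j divides x)"
    using insert by blast
  have "p i [^] a i \<otimes> ?P divides x \<longleftrightarrow> p i [^] a i divides x \<and> ?P divides x"
  proof
    assume "p i [^] a i \<otimes> ?P divides x"
    moreover have "p i [^] a i divides p i [^] a i \<otimes> ?P" "?P divides p i [^] a i \<otimes> ?P"
      using closed by (simp_all add: divides_prod_l divides_prod_r)
    ultimately show "p i [^] a i divides x \<and> ?P divides x"
      using divides_trans[OF _ _ closed(1)] divides_trans[OF _ _ closed(2)] by blast
  next
    assume A: "p i [^] a i divides x \<and> ?P divides x"
    then obtain t where t: "t \<in> carrier R" "x = ?P \<otimes> t" unfolding factor_def by blast
    have "p i [^] a i divides ?P \<otimes> t" using A t by simp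
    then obtain b where b: "b \<le> a i" "p i [^] b divides ?P" "p i [^] (a i - b) divides t"
      using prime_power_divides_mult_iff[OF pi] closed t by blast
    have "b = 0"
    proof (rule ccontr)
      assume "b \<noteq> 0"
      then have "p i [^] (1::nat) divides p i [^] b" using pi by (intro pow_divides_pow) auto
      then have "p i divides ?P" using b pi divides_trans by (metis nat_pow_eone)
      then obtain j where j: "j \<in> A" "p i divides p j [^] a j"
        using ring_prime_divides_finprod[OF pi, of A "\<lambda>j. p j [^] a j"] insert.hyps insert.prems
        by auto
      then have "p i divides p j" using ring_prime_divides_pow[OF pi] insert.prems(1) by blast
      then show False using insert.prems(2)[of i j] insert.hyps j by blast
    qed
    then have "p i [^] a i divides t" using b by simp
    then show "p i [^] a i \<otimes> ?P divides x"
      using t closed by (metis divides_mult_rI m_comm)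
  qed
  then show ?case using IH eq by simp
qed

end

subsection \<open>Quotients by principal ideals\<close>

context cring
begin

lemma mem_PIdl_iff: "a \<in> carrier R \<Longrightarrow> x \<in> PIdl a \<longleftrightarrow> a divides x"
  unfolding cgenideal_def factor_def using m_comm by blast

lemma carrier_Quot: "carrier (R Quot I) = (+>) I ` carrier R"
  unfolding FactRing_def A_RCOSETS_def' by auto

lemma coset_eq_iff:
  assumes "a \<in> carrier R" "x \<in> carrier R" "y \<in> carrier R"
  shows "PIdl a +> x = PIdl a +> y \<longleftrightarrow> a divides (x \<ominus> y)"
  using quotient_eq_iff_same_a_r_cos[OF cgenideal_ideal[OF assms(1)] assms(2,3)]
    mem_PIdl_iff[OF assms(1)] by simp

lemma coset_eq_zero_iff:
  assumes "a \<in> carrier R" "x \<in> carrier R"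
  shows "PIdl a +> x = \<zero>\<^bsub>R Quot PIdl a\<^esub> \<longleftrightarrow> a divides x"
  using coset_eq_iff[OF assms zero_closed] a_rcos_zero[OF cgenideal_ideal[OF assms(1)]]
    assms mem_PIdl_iff[OF assms(1) ] divides_zero
  by (simp add: FactRing_def minus_eq)

lemma coset_mult:
  assumes "a \<in> carrier R" "x \<in> carrier R" "y \<in> carrier R"
  shows "(PIdl a +> x) \<otimes>\<^bsub>R Quot PIdl a\<^esub> (PIdl a +> y) = PIdl a +> (x \<otimes> y)"
  using ideal.rcoset_mult_add[OF cgenideal_ideal[OF assms(1)] assms(2,3)] by (simp add: FactRing_def)

text \<open>The cosets of 0 and 1 differ because \<open>a\<close> is a non-unit, so size 2 means
  that they are the only ones. In terms of divisibility this can be combined with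
  valuations.\<close>

lemma card_Quot_eq_2_iff:
  assumes a: "a \<in> carrier R" "a \<notin> Units R"
  shows "card (carrier (R Quot PIdl a)) = 2 \<longleftrightarrow>
    (\<forall>x\<in>carrier R. a divides x \<or> a divides (x \<ominus> \<one>))"
proof -
  let ?c = "\<lambda>x. PIdl a +> x"
  have ne: "?c \<zero> \<noteq> ?c \<one>"
  proof
    assume "?c \<zero> = ?c \<one>"
    then have "a divides (\<one> \<ominus> \<zero>)" using coset_eq_iff[of a \<one> \<zero>] a by simp
    then show False using a divides_one by (simp add: minus_eq)
  qed
  have eq: "a divides x \<or> a divides (x \<ominus> \<one>) \<longleftrightarrow> ?c x \<in> {?c \<zero>, ?c \<one>}" if "x \<in> carrier R" for x
    using that a coset_eq_iff[of a x \<zero>] coset_eq_iff[of a x \<one>] by (simp add: minus_eq)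
  have sub: "{?c \<zero>, ?c \<one>} \<subseteq> carrier (R Quot PIdl a)" by (auto simp: carrier_Quot)
  have "card (carrier (R Quot PIdl a)) = 2 \<longleftrightarrow> carrier (R Quot PIdl a) = {?c \<zero>, ?c \<one>}"
  proof
    assume c: "card (carrier (R Quot PIdl a)) = 2"
    \<comment> \<open>An infinite set has \<open>card\<close> 0, so \<open>card\<close> 2 entails
      finiteness.\<close>
    then have "finite (carrier (R Quot PIdl a))" by (metis card.infinite zero_neq_numeral)
    from card_subset_eq[OF this sub] show "carrier (R Quot PIdl a) = {?c \<zero>, ?c \<one>}"
      using c ne by simp
  qed (use ne in simp)
  also have "\<dots> \<longleftrightarrow> (\<forall>x\<in>carrier R. ?c x \<in> {?c \<zero>, ?c \<one>})"
    using sub unfolding carrier_Quot by blast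
  finally show ?thesis using eq by blast
qed

end

section \<open>The ring modulo a product of prime powers\<close>

locale prime_product_quotient = domain R for R (structure) +
  fixes g u :: 'a and p :: "nat \<Rightarrow> 'a" and m :: "nat \<Rightarrow> nat" and n :: nat
  assumes finite_quotient: "finite (carrier (R Quot PIdl g))"
    and u: "u \<in> Units R"
    and p: "\<And>i. i \<in> {1..n} \<Longrightarrow> p i \<in> carrier R \<and> ring_prime (p i)"
    and not_assoc: "\<And>i j. i \<in> {1..n} \<Longrightarrow> j \<in> {1..n} \<Longrightarrow> i \<noteq> j \<Longrightarrow> \<not> p i \<sim> p j"
    and m: "\<And>i. i \<in> {1..n} \<Longrightarrow> m i \<ge> 1"
    and g: "g = u \<otimes> (\<Otimes>i\<in>{1..n}. p i [^] m i)"
    and n: "n \<ge> 2"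
begin

lemma not_divides: "i \<in> {1..n} \<Longrightarrow> j \<in> {1..n} \<Longrightarrow> i \<noteq> j \<Longrightarrow> \<not> p i divides p j"
  using ring_prime_divides_imp_associated p not_assoc by metis

lemma prod_closed: "(\<Otimes>i\<in>{1..n}. p i [^] (a i :: nat)) \<in> carrier R"
  using p by (simp add: Pi_iff)

lemma g_closed: "g \<in> carrier R"
  using g u prod_closed by auto

lemma g_divides_iff:
  assumes "x \<in> carrier R"
  shows "g divides x \<longleftrightarrow> (\<forall>i\<in>{1..n}. p i [^] m i divides x)"
proof -
  let ?P = "\<Otimes>i\<in>{1..n}. p i [^] m i"
  have "g \<sim> ?P"
    using g u prod_closed by (metis Units_closed associatedI2' m_comm)
  then have "g divides ?P" "?P divides g" by (simp_all add: associated_def)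
  then have "g divides x \<longleftrightarrow> ?P divides x"
    using divides_trans[OF _ _ g_closed] divides_trans[OF _ _ prod_closed] by blast
  also have "\<dots> \<longleftrightarrow> (\<forall>i\<in>{1..n}. p i [^] m i divides x)"
    using assms p not_divides by (intro prod_divides_iff) auto
  finally show ?thesis .
qed

definition coset_val :: "nat \<Rightarrow> 'a set \<Rightarrow> nat" where
  "coset_val i C = capped_val (p i) (m i) (SOME x. x \<in> carrier R \<and> C = PIdl g +> x)"

text \<open>Independence of the chosen representative: two of them differ by a multiple of g, hence
  of p_i^(m_i), so the same powers of p_i up to the cap m_i divide both.\<close>

lemma coset_val:
  assumes "i \<in> {1..n}" "x \<in> carrier R"
  shows "coset_val i (PIdl g +> x) = capped_val (p i) (m i) x"
proof -
  define y where "y = (SOME y. y \<in> carrier R \<and> PIdl g +> x = PIdl g +> y)"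
  have y: "y \<in> carrier R \<and> PIdl g +> x = PIdl g +> y"
    unfolding y_def by (rule someI[of _ x]) (use assms in simp)
  have pi: "p i \<in> carrier R" using p assms by blast
  have "p i [^] m i divides (x \<ominus> y)"
    using y assms coset_eq_iff g_closed g_divides_iff by (metis minus_closed)
  then obtain c where c: "c \<in> carrier R" "x \<ominus> y = p i [^] m i \<otimes> c" unfolding factor_def by blast
  have div: "p i [^] k divides x \<longleftrightarrow> p i [^] k divides y" if "k \<le> m i" for k
  proof -
    let ?d = "p i [^] (m i - k) \<otimes> c"
    have "p i [^] m i = p i [^] k \<otimes> p i [^] (m i - k)" using that pi by (simp add: nat_pow_mult)
    then have xy: "x \<ominus> y = p i [^] k \<otimes> ?d" using c pi by (simp add: m_assoc)
    have "x = (x \<ominus> y) \<oplus> y" "y = x \<ominus> (x \<ominus> y)" using y assms by algebra+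
    then have x: "x = p i [^] k \<otimes> ?d \<oplus> y" and y': "y = x \<ominus> p i [^] k \<otimes> ?d" using xy by auto
    have d: "?d \<in> carrier R" "p i [^] k \<in> carrier R" using c pi by auto
    show ?thesis
    proof
      assume "p i [^] k divides x"
      then obtain e where e: "e \<in> carrier R" "x = p i [^] k \<otimes> e" unfolding factor_def by blast
      have "y = p i [^] k \<otimes> (e \<ominus> ?d)"
        by (subst y', subst e(2)) (use d e in \<open>simp add: minus_eq r_distr r_minus\<close>)
      then show "p i [^] k divides y" using d e by (intro dividesI) auto
    next
      assume "p i [^] k divides y"
      then obtain e where e: "e \<in> carrier R" "y = p i [^] k \<otimes> e" unfolding factor_def by blast
      have "x = p i [^] k \<otimes> (?d \<oplus> e)"
        by (subst x, subst e(2)) (use d e in \<open>simp add: r_distr\<close>)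
      then show "p i [^] k divides x" using d e by (intro dividesI) auto
    qed
  qed
  then have "{k. k \<le> m i \<and> p i [^] k divides y} = {k. k \<le> m i \<and> p i [^] k divides x}" by blast
  then show ?thesis unfolding coset_val_def y_def[symmetric] capped_val_def by simp
qed

lemma capped_val_eq_iff:
  assumes "i \<in> {1..n}" "x \<in> carrier R"
  shows "capped_val (p i) (m i) x = m i \<longleftrightarrow> p i [^] m i divides x"
  using le_capped_val_iff[of "p i" x "m i" "m i"] capped_val_le[of x "p i" "m i"] assms p by auto

text \<open>All graph-theoretic bounds become available here. The valuation vector \<open>a\<close>
  is realised by the coset of the product of the p_i^(a_i).\<close>

sublocale valued_quotient "R Quot PIdl g" coset_val m n
proof
  fix x y assume "x \<in> carrier (R Quot PIdl g)" "y \<in> carrier (R Quot PIdl g)"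
  then obtain a b where "a \<in> carrier R" "x = PIdl g +> a" "b \<in> carrier R" "y = PIdl g +> b"
    by (auto simp: carrier_Quot)
  then show "x \<otimes>\<^bsub>R Quot PIdl g\<^esub> y = \<zero>\<^bsub>R Quot PIdl g\<^esub> \<longleftrightarrow>
      (\<forall>i\<in>{1..n}. m i \<le> coset_val i x + coset_val i y)"
    using coset_mult g_closed coset_eq_zero_iff g_divides_iff le_capped_val_add_iff p
    by (simp add: coset_val)
next
  fix x assume "x \<in> carrier (R Quot PIdl g)"
  then obtain a where a: "a \<in> carrier R" "x = PIdl g +> a"
    by (auto simp: carrier_Quot)
  then show "x = \<zero>\<^bsub>R Quot PIdl g\<^esub> \<longleftrightarrow> (\<forall>i\<in>{1..n}. coset_val i x = m i)"
    using g_closed coset_eq_zero_iff g_divides_iff capped_val_eq_iff by (simp add: coset_val)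
  show "coset_val i x \<le> m i" if "i \<in> {1..n}" for i
    using that a capped_val_le by (simp add: coset_val)
next
  show "\<zero>\<^bsub>R Quot PIdl g\<^esub> \<in> carrier (R Quot PIdl g)"
    using coset_eq_zero_iff[OF g_closed zero_closed] g_closed divides_zero
    by (auto simp: carrier_Quot)
next
  fix a :: "nat \<Rightarrow> nat" assume a: "\<And>i. i \<in> {1..n} \<Longrightarrow> a i \<le> m i"
  let ?P = "\<Otimes>i\<in>{1..n}. p i [^] a i"
  have "coset_val i (PIdl g +> ?P) = a i" if "i \<in> {1..n}" for i
    unfolding coset_val[OF that prod_closed]
    using that a p not_divides by (intro capped_val_prod) auto
  then show "\<exists>x\<in>carrier (R Quot PIdl g). \<forall>i\<in>{1..n}. coset_val i x = a i"
    unfolding carrier_Quot using prod_closed[of a] by blast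
qed (use finite_quotient m n in auto)

section \<open>Residue fields and the number of coatoms\<close>

lemma p_not_unit: "i \<in> {1..n} \<Longrightarrow> p i \<notin> Units R"
  using p ring_prime_not_unit by blast

lemma capped_val_eq_0_iff:
  assumes "i \<in> {1..n}" "x \<in> carrier R"
  shows "capped_val (p i) (m i) x = 0 \<longleftrightarrow> \<not> p i divides x"
  using le_capped_val_iff[of "p i" x 1 "m i"] assms p m[of i] by (auto simp: Suc_le_eq)

text \<open>Representatives of both coatoms are prime to p_k, hence congruent to 1 modulo p_k, and
  since m_k = 1 this is all that g demands at k. At the other indices both are divisible by
  p_i^(m_i), so g divides their difference.\<close>

lemma unique_coatom:
  assumes k: "k \<in> {1..n}" "m k = 1" and card: "card (carrier (R Quot PIdl (p k))) = 2"
    and "coatom k C" "coatom k D"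
  shows "C = D"
proof -
  have pk: "p k \<in> carrier R" using p k by blast
  obtain x y where x: "x \<in> carrier R" "C = PIdl g +> x" and y: "y \<in> carrier R" "D = PIdl g +> y"
    using assms by (auto simp: coatom_def carrier_Quot)
  have "p i [^] m i divides (x \<ominus> y)" if i: "i \<in> {1..n}" for i
  proof (cases "i = k")
    case True
    have "coset_val k C = 0" "coset_val k D = 0"
      using assms(4,5) by (simp_all add: coatom_def)
    then have "\<not> p k divides x" "\<not> p k divides y"
      using x y capped_val_eq_0_iff[OF k(1)] coset_val[OF k(1)] by simp_all
    then have "p k divides (x \<ominus> \<one>)" "p k divides (y \<ominus> \<one>)"
      using card card_Quot_eq_2_iff[OF pk p_not_unit[OF k(1)]] x y by auto
    then have "PIdl (p k) +> x = PIdl (p k) +> \<one>" "PIdl (p k) +> y = PIdl (p k) +> \<one>"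
      using coset_eq_iff[OF pk] x y by simp_all
    then have "PIdl (p k) +> x = PIdl (p k) +> y" by simp
    then show ?thesis using coset_eq_iff[OF pk] x y True k pk by simp
  next
    case False
    then have "coset_val i C = m i" "coset_val i D = m i"
      using assms(4,5) i by (simp_all add: coatom_def)
    then have "p i [^] m i divides x" "p i [^] m i divides y"
      using i x y capped_val_eq_iff[OF i] coset_val[OF i] by simp_all
    then obtain c d where "c \<in> carrier R" "d \<in> carrier R" "x = p i [^] m i \<otimes> c" "y = p i [^] m i \<otimes> d"
      using dividesD by metis
    then have "x \<ominus> y = p i [^] m i \<otimes> (c \<ominus> d)" "c \<ominus> d \<in> carrier R"
      using p[OF i] by (auto simp: minus_eq r_distr r_minus)
    then show ?thesis by (rule dividesI[rotated])
  qed
  then show ?thesis using x y coset_eq_iff g_closed g_divides_iff by simp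
qed

text \<open>Since p_k is a non-unit, size other than 2 yields w with neither w nor w - 1 divisible
  by p_k. If x represents a coatom at \<open>k\<close>, so does w x, and w x - x = (w - 1) x is
  prime to p_k, so the two cosets differ.\<close>

lemma two_coatoms:
  assumes k: "k \<in> {1..n}" and card: "card (carrier (R Quot PIdl (p k))) \<noteq> 2"
  shows "\<exists>C D. coatom k C \<and> coatom k D \<and> C \<noteq> D"
proof -
  have pk: "p k \<in> carrier R" "ring_prime (p k)" using p k by auto
  obtain w where w: "w \<in> carrier R" "\<not> p k divides w" "\<not> p k divides (w \<ominus> \<one>)"
    using card card_Quot_eq_2_iff[OF pk(1) p_not_unit[OF k]] by blast
  obtain C where C: "C \<in> carrier (R Quot PIdl g)"
      "\<forall>i\<in>{1..n}. coset_val i C = (if i = k then 0 else m i)"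
    using val_realize[of "\<lambda>i. if i = k then 0 else m i"] by force
  then obtain x where x: "x \<in> carrier R" "C = PIdl g +> x" by (auto simp: carrier_Quot)
  have "coset_val k C = 0" using C(2) k by simp
  then have nx: "\<not> p k divides x"
    using x k capped_val_eq_0_iff[OF k] coset_val[OF k] by simp
  have prime: "\<not> p k divides y \<otimes> x" if "y \<in> carrier R" "\<not> p k divides y" for y
    using that nx x ring_prime_divides_mult[OF pk] by blast
  have "coatom k C" using C k by (auto simp: coatom_def)
  moreover have "coatom k (PIdl g +> (w \<otimes> x))"
    unfolding coatom_def
  proof (intro conjI ballI)
    show "PIdl g +> (w \<otimes> x) \<in> carrier (R Quot PIdl g)" using w x by (auto simp: carrier_Quot)
    show "coset_val k (PIdl g +> (w \<otimes> x)) = 0"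
      using prime w x k by (simp add: coset_val capped_val_eq_0_iff)
    fix i assume i: "i \<in> {1..n} - {k}"
    then have "coset_val i C = m i" using C(2) by simp
    then have "p i [^] m i divides x"
      using i x capped_val_eq_iff[of i x] coset_val[of i x] by simp
    then have "p i [^] m i divides w \<otimes> x" using w x i p by (intro divides_prod_l) auto
    then show "coset_val i (PIdl g +> (w \<otimes> x)) = m i"
      using i w x capped_val_eq_iff[of i "w \<otimes> x"] by (auto simp: coset_val)
  qed
  moreover have "C \<noteq> PIdl g +> (w \<otimes> x)"
  proof
    assume "C = PIdl g +> (w \<otimes> x)"
    then have "g divides (w \<otimes> x \<ominus> x)" using x w coset_eq_iff[of g "w \<otimes> x" x] g_closed by simp
    then have "p k [^] m k divides (w \<otimes> x \<ominus> x)" using g_divides_iff k w x by simp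
    moreover have "p k divides p k [^] m k"
      using pow_divides_pow[of "p k" 1 "m k"] pk m[OF k] by simp
    moreover have "w \<otimes> x \<ominus> x = (w \<ominus> \<one>) \<otimes> x" using w x by algebra
    ultimately show False using prime[of "w \<ominus> \<one>"] w pk divides_trans by (metis minus_closed one_closed)
  qed
  ultimately show ?thesis by blast
qed

end

theorem theorem80:
  fixes R :: "('a, 'm) ring_scheme" (structure)
    and g u :: 'a and p :: "nat \<Rightarrow> 'a" and m :: "nat \<Rightarrow> nat" and n :: nat
    and I :: "'a set" and Q :: "'a set ring"
  assumes "principal_domain R"
    and "g \<in> carrier R" and "I = PIdl g"
    and "I \<subset> carrier R" and "\<not> primeideal I R"
    and "Q = R Quot I" and "finite (carrier Q)"
    and "u \<in> Units R"
    and "\<And>i. i \<in> {1..n} \<Longrightarrow> p i \<in> carrier R \<and> ring_prime (p i)"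
    and "\<And>i j. i \<in> {1..n} \<Longrightarrow> j \<in> {1..n} \<Longrightarrow> i \<noteq> j \<Longrightarrow> \<not> p i \<sim> p j"
    and "\<And>i. i \<in> {1..n} \<Longrightarrow> m i \<ge> 1"
    and "g = u \<otimes> (\<Otimes>i\<in>{1..n}. p i [^] m i)"
    and "n \<ge> 2"
  shows
    "((\<exists>i\<in>{1..n}. m i \<ge> 2) \<longrightarrow> threshold_dim (zero_divisor_graph Q) = n) \<and>
     ((\<forall>i\<in>{1..n}. card (carrier (R Quot (PIdl (p i)))) \<ge> 3) \<longrightarrow>
        threshold_dim (zero_divisor_graph Q) = n) \<and>
     (n \<ge> 3 \<and> (\<forall>i\<in>{1..n}. m i = 1) \<and>
      (\<exists>i\<in>{1..n}. card (carrier (R Quot (PIdl (p i)))) = 2) \<longrightarrow>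
        threshold_dim (zero_divisor_graph Q) = n - 1) \<and>
     (n = 2 \<and> m 1 = 1 \<and> m 2 = 1 \<and>
      (\<exists>!i. i \<in> {1, 2} \<and> card (carrier (R Quot (PIdl (p i)))) = 2) \<longrightarrow>
        threshold_dim (zero_divisor_graph Q) = 1) \<and>
     (n = 2 \<and> m 1 = 1 \<and> m 2 = 1 \<and>
      card (carrier (R Quot (PIdl (p 1)))) = 2 \<and>
      card (carrier (R Quot (PIdl (p 2)))) = 2 \<longrightarrow>
        threshold_dim (zero_divisor_graph Q) = 0)"
proof -
  interpret principal_domain R by fact
  interpret prime_product_quotient R g u p m n
    using assms by unfold_locales auto
  have Q: "Q = R Quot PIdl g" using assms by simp
  let ?card = "\<lambda>i. card (carrier (R Quot PIdl (p i)))"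
  have two: "\<And>i. n = 2 \<Longrightarrow> i \<in> {1..n} \<longleftrightarrow> i \<in> {1, 2}" by auto
  show ?thesis
    unfolding Q
  proof (intro conjI impI)
    assume "\<exists>i\<in>{1..n}. m i \<ge> 2"
    then show "threshold_dim (zero_divisor_graph (R Quot PIdl g)) = n"
      using dim_repeated_factor by blast
  next
    assume "\<forall>i\<in>{1..n}. ?card i \<ge> 3"
    then have "?card i \<noteq> 2" if "i \<in> {1..n}" for i using that by fastforce
    then have "card {1..n} \<le> threshold_dim (zero_divisor_graph (R Quot PIdl g))"
      by (intro card_le_dim_coatoms two_coatoms) auto
    then show "threshold_dim (zero_divisor_graph (R Quot PIdl g)) = n"
      using dim_le by simp
  next
    assume "n \<ge> 3 \<and> (\<forall>i\<in>{1..n}. m i = 1) \<and> (\<exists>i\<in>{1..n}. ?card i = 2)"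
    then obtain k where A: "n \<ge> 3" "\<And>i. i \<in> {1..n} \<Longrightarrow> m i = 1" "k \<in> {1..n}" "?card k = 2"
      by blast
    then show "threshold_dim (zero_divisor_graph (R Quot PIdl g)) = n - 1"
      using dim_le_unique_coatom[OF A(2,3) unique_coatom[OF A(3) A(2)[OF A(3)] A(4)]]
        dim_ge_pred[OF A(2,1)] by simp
  next
    assume A: "n = 2 \<and> m 1 = 1 \<and> m 2 = 1 \<and> (\<exists>!i. i \<in> {1, 2} \<and> ?card i = 2)"
    then have m1: "m i = 1" if "i \<in> {1..n}" for i using that two by auto
    obtain k l where k: "k \<in> {1..n}" "?card k = 2" and l: "l \<in> {1..n}" "?card l \<noteq> 2"
      using A two by (metis insertCI numeral_eq_one_iff semiring_norm(85))
    \<comment> \<open>The two indices play opposite parts: the unique coatom at k gives the upper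
      bound n - 1 = 1, and two coatoms at l form a non-edge, so the dimension is not 0.\<close>
    have "threshold_dim (zero_divisor_graph (R Quot PIdl g)) \<le> n - 1"
      using dim_le_unique_coatom[OF m1 k(1) unique_coatom[OF k(1) m1[OF k(1)] k(2)]] by simp
    moreover have "card {l} \<le> threshold_dim (zero_divisor_graph (R Quot PIdl g))"
      using l by (intro card_le_dim_coatoms two_coatoms) auto
    ultimately show "threshold_dim (zero_divisor_graph (R Quot PIdl g)) = 1"
      using A by simp
  next
    assume A: "n = 2 \<and> m 1 = 1 \<and> m 2 = 1 \<and> ?card 1 = 2 \<and> ?card 2 = 2"
    then have m1: "m i = 1" and "?card i = 2" if "i \<in> {1..n}" for i using that two by auto
    then show "threshold_dim (zero_divisor_graph (R Quot PIdl g)) = 0"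
      using A m1 unique_coatom by (intro dim_two_unique_coatoms) blast+
  qed
qed

end
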